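(* Let $(A,+)$ be an abelian group and $H$ a non-empty set. For a family $\{S_\lambda\}_{\lambda\in H}$ of subsets of $A\rtimes\mathrm{Aut}(A)$ consider the conditions (required for every $\lambda\in H$): (a) for every $a\in A$ there exists a unique $f\in\mathrm{Aut}(A)$ such that $(a,f)\in S_\lambda$ (this $f$ is denoted $f_\lambda(a)$); (b) for every $(a,f)\in S_\lambda$ there exists a unique $\mu\in H$ such that $(a,f)^{-1}S_\lambda:=\{(a,f)^{-1}(b,g)\mid(b,g)\in S_\lambda\}=S_\mu$. (1) Let $(A,H,\phi;+,\{\cdot_\lambda\}_{\lambda\in H})$ be a dynamical brace. For $\lambda\in H$ and $a\in A$ let $R_\lambda(a):A\to A$, $b\mapsto b*_\lambda a$, where $b*_\lambda a:=b\cdot_\lambda a+b+a$, and set $S_\lambda:=\{R_\lambda(a)\mid a\in A\}\subset A\rtimes\mathrm{Aut}(A)$. Then the family $\{S_\lambda\}_{\lambda\in H}$ satisfies (a) and (b). (2) Let $\{S_\lambda\}_{\lambda\in H}$ be a family of subsets of $A\rtimes\mathrm{Aut}(A)$ satisfying (a) and (b). Define multiplications $\{\cdot_\lambda\}_{\lambda\in H}$ on $A$ by $a\cdot_\lambda b:=f_\lambda(b)(a)-a$, and define a map $\phi:H\times A\to H$ by letting $\phi(\lambda,a)$ be the $\mu$ determined by (b) for the element $(a,f_\lambda(a))\in S_\lambda$. Then $(A,H,\phi;+,\{\cdot_\lambda\}_{\lambda\in H})$ is a dynamical brace. (3) The correspondence between (1) and (2) is one-to-one.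
   Context: Dynamical brace: Let $H$ be a non-empty set, $(A,+)$ an abelian group with a family of multiplications (binary operations, not assumed associative) $\{\cdot_\lambda:A\times A\to A\}_{\lambda\in H}$, and $\phi:H\times A\to H$ a map. $(A,H,\phi;+,\{\cdot_\lambda\}_{\lambda\in H})$ is called a dynamical brace (d-brace) if for all $(\lambda,a,b,c)\in H\times A\times A\times A$: 1. $(a+b)\cdot_\lambda c=a\cdot_\lambda c+b\cdot_\lambda c$; 2. $a\cdot_\lambda(b\cdot_\lambda c+b+c)=(a\cdot_{\phi(\lambda,c)}b)\cdot_\lambda c+a\cdot_{\phi(\lambda,c)}b+a\cdot_\lambda c$; 3. the map $\gamma_\lambda(b):A\to A$, $a\mapsto a\cdot_\lambda b+a$, is bijective. $\mathrm{Aut}(A)$ is the automorphism group of $(A,+)$. The semidirect product $A\rtimes\mathrm{Aut}(A)$ has multiplication $(a,f)(b,g)=(a+f(b),fg)$ and acts on $A$ by sending $b$ to $f(b)+a$ under $(a,f)$; elements of $A\rtimes\mathrm{Aut}(A)$ are identified with the maps $A\to A$ through which they act. Thus $R_\lambda(a)$ is identified with $(a,\gamma_\lambda(a))$.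
   Formalization: Uniqueness of μ in (b) fails if braces repeat multiplications (e.g. all zero, |H|=2); so in (1) it is shown to hold iff each φ(λ,a) is determined by its multiplication, and (3) is proved for such braces, and for all braces if φ is kept as data. *)

theory Defs
  imports Complex_Main "HOL-Algebra.Coset"
begin

text \<open>
  The abelian group is the additive group of a type \<open>'a\<close> of class \<open>ab_group_add\<close>, and the non-empty
  parameter set \<open>H\<close> is a type \<open>'h\<close>.  The product written with index \<open>l\<close> is \<open>dot l a b\<close>.
\<close>

definition dynamical_brace ::
  "('h \<Rightarrow> 'a::ab_group_add \<Rightarrow> 'a \<Rightarrow> 'a) \<Rightarrow> ('h \<Rightarrow> 'a \<Rightarrow> 'h) \<Rightarrow> bool" where
  "dynamical_brace dot phi \<longleftrightarrow>
     (\<forall>l a b c. dot l (a + b) c = dot l a c + dot l b c) \<and>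
     (\<forall>l a b c. dot l a (dot l b c + b + c) =
        dot l (dot (phi l c) a b) c + dot (phi l c) a b + dot l a c) \<and>
     (\<forall>l b. bij (\<lambda>a. dot l a b + a))"

definition Aut :: "('a::ab_group_add \<Rightarrow> 'a) set" where
  "Aut = {f. additive f \<and> bij f}"

definition semidirect :: "('a::ab_group_add \<times> ('a \<Rightarrow> 'a)) monoid" where
  "semidirect = \<lparr>carrier = UNIV \<times> Aut,
     monoid.mult = (\<lambda>(a, f) (b, g). (a + f b, f \<circ> g)), one = (0, id)\<rparr>"

definition acts :: "'a::ab_group_add \<times> ('a \<Rightarrow> 'a) \<Rightarrow> 'a \<Rightarrow> 'a" where
  "acts p b = snd p b + fst p"

lemma Aut_comp: "f \<in> Aut \<Longrightarrow> g \<in> Aut \<Longrightarrow> f \<circ> g \<in> Aut"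
  by (auto simp: Aut_def additive_def intro: bij_comp)

lemma id_in_Aut: "id \<in> Aut"
  by (auto simp: Aut_def additive_def)

lemma inv_in_Aut:
  assumes "f \<in> Aut"
  shows "inv_into UNIV f \<in> Aut"
proof -
  have f: "additive f" "bij f" using assms by (auto simp: Aut_def)
  have "inv_into UNIV f (x + y) = inv_into UNIV f x + inv_into UNIV f y" for x y
    by (rule inv_f_eq) (use f in \<open>auto simp: additive.add bij_is_inj bij_is_surj surj_f_inv_f\<close>)
  then show ?thesis using f by (simp add: Aut_def additive_def bij_imp_bij_inv)
qed

lemma group_semidirect: "group (semidirect :: ('a::ab_group_add \<times> ('a \<Rightarrow> 'a)) monoid)"
proof (rule groupI, goal_cases)
  case (1 x y)
  then show ?case by (auto simp: semidirect_def Aut_comp)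
next
  case 2
  then show ?case by (simp add: semidirect_def id_in_Aut)
next
  case (3 x y z)
  then show ?case
    by (auto simp: semidirect_def Aut_def additive.add algebra_simps)
next
  case (4 x)
  then show ?case by (auto simp: semidirect_def)
next
  case (5 x)
  obtain a f where x: "x = (a, f)" by (cases x)
  with 5 have f: "f \<in> Aut" by (simp add: semidirect_def)
  then have bij: "bij f" by (simp add: Aut_def)
  show ?case
    by (rule bexI[of _ "(- inv_into UNIV f a, inv_into UNIV f)"])
      (use f bij in \<open>auto simp: x semidirect_def inv_in_Aut bij_is_inj\<close>)
qed

text \<open>Elements of the semidirect product may be identified with the maps through which they act.\<close>

lemma acts_mult: "x \<in> carrier semidirect \<Longrightarrow> acts (x \<otimes>\<^bsub>semidirect\<^esub> y) = acts x \<circ> acts y"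
  by (auto simp: semidirect_def acts_def Aut_def additive.add fun_eq_iff algebra_simps
      split: prod.splits)

lemma inj_on_acts: "inj_on acts (carrier semidirect)"
proof (rule inj_onI)
  fix x y :: "'a \<times> ('a \<Rightarrow> 'a)"
  assume "x \<in> carrier semidirect" "y \<in> carrier semidirect" and eq: "acts x = acts y"
  then have "snd x 0 = 0" "snd y 0 = 0"
    by (auto simp: semidirect_def Aut_def additive.zero)
  with fun_cong[OF eq, of 0] have fst: "fst x = fst y" by (simp add: acts_def)
  with eq have "snd x = snd y" by (simp add: acts_def fun_eq_iff)
  with fst show "x = y" by (simp add: prod_eq_iff)
qed

definition subset_family :: "('h \<Rightarrow> ('a::ab_group_add \<times> ('a \<Rightarrow> 'a)) set) \<Rightarrow> bool" where
  "subset_family S \<longleftrightarrow> (\<forall>l. S l \<subseteq> carrier semidirect)"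

definition condition_a :: "('h \<Rightarrow> ('a::ab_group_add \<times> ('a \<Rightarrow> 'a)) set) \<Rightarrow> bool" where
  "condition_a S \<longleftrightarrow> (\<forall>l a. \<exists>!f. f \<in> Aut \<and> (a, f) \<in> S l)"

definition condition_b :: "('h \<Rightarrow> ('a::ab_group_add \<times> ('a \<Rightarrow> 'a)) set) \<Rightarrow> bool" where
  "condition_b S \<longleftrightarrow>
     (\<forall>l. \<forall>p\<in>S l. \<exists>!\<mu>. inv\<^bsub>semidirect\<^esub> p <#\<^bsub>semidirect\<^esub> S l = S \<mu>)"

definition R_map :: "('h \<Rightarrow> 'a::ab_group_add \<Rightarrow> 'a \<Rightarrow> 'a) \<Rightarrow> 'h \<Rightarrow> 'a \<Rightarrow> 'a \<Rightarrow> 'a" where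
  "R_map dot l a b = dot l b a + b + a"

definition family_of ::
  "('h \<Rightarrow> 'a::ab_group_add \<Rightarrow> 'a \<Rightarrow> 'a) \<Rightarrow> 'h \<Rightarrow> ('a \<times> ('a \<Rightarrow> 'a)) set" where
  "family_of dot l = {p \<in> carrier semidirect. \<exists>a. acts p = R_map dot l a}"

definition aut_at ::
  "('h \<Rightarrow> ('a::ab_group_add \<times> ('a \<Rightarrow> 'a)) set) \<Rightarrow> 'h \<Rightarrow> 'a \<Rightarrow> 'a \<Rightarrow> 'a" where
  "aut_at S l a = (THE f. f \<in> Aut \<and> (a, f) \<in> S l)"

definition dot_of ::
  "('h \<Rightarrow> ('a::ab_group_add \<times> ('a \<Rightarrow> 'a)) set) \<Rightarrow> 'h \<Rightarrow> 'a \<Rightarrow> 'a \<Rightarrow> 'a" where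
  "dot_of S l a b = aut_at S l b a - a"

definition phi_of ::
  "('h \<Rightarrow> ('a::ab_group_add \<times> ('a \<Rightarrow> 'a)) set) \<Rightarrow> 'h \<Rightarrow> 'a \<Rightarrow> 'h" where
  "phi_of S l a =
     (THE \<mu>. inv\<^bsub>semidirect\<^esub> (a, aut_at S l a) <#\<^bsub>semidirect\<^esub> S l = S \<mu>)"

definition translates_along ::
  "('h \<Rightarrow> ('a::ab_group_add \<times> ('a \<Rightarrow> 'a)) set) \<Rightarrow> ('h \<Rightarrow> 'a \<Rightarrow> 'h) \<Rightarrow> bool" where
  "translates_along S phi \<longleftrightarrow>
     (\<forall>l a. inv\<^bsub>semidirect\<^esub> (a, aut_at S l a) <#\<^bsub>semidirect\<^esub> S l = S (phi l a))"

text \<open>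
  A dynamical brace may use the same multiplication for several parameters.  Its family of subsets
  then repeats a member, and the uniqueness of \<open>\<mu>\<close> in \<open>condition_b\<close> can fail (see
  \<open>zero_brace_not_condition_b\<close> below).  Uniqueness holds exactly when every value of \<open>phi\<close> is
  determined among all parameters by its multiplication (\<open>phi_determined\<close>).  Without that property the existence of
  \<open>\<mu>\<close> still holds, with \<open>\<mu> = phi l a\<close>; but \<open>phi\<close> cannot be recovered from the family
  and has to be kept as part of the data, which is what \<open>translates_along\<close> expresses.
\<close>

definition phi_determined ::
  "('h \<Rightarrow> 'a::ab_group_add \<Rightarrow> 'a \<Rightarrow> 'a) \<Rightarrow> ('h \<Rightarrow> 'a \<Rightarrow> 'h) \<Rightarrow> bool" where
  "phi_determined dot phi \<longleftrightarrow> (\<forall>l a \<mu>. dot \<mu> = dot (phi l a) \<longrightarrow> \<mu> = phi l a)"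

lemma zero_brace_not_condition_b:
  fixes dot :: "bool \<Rightarrow> 'a::ab_group_add \<Rightarrow> 'a \<Rightarrow> 'a"
  assumes "dot = (\<lambda>_ _ _. 0)"
  shows "dynamical_brace dot phi" and "\<not> condition_b (family_of dot)"
proof -
  show "dynamical_brace dot phi"
    unfolding dynamical_brace_def assms by (simp add: bij_id[unfolded id_def])
  have "(0, id) \<in> family_of dot True"
    by (auto simp: family_of_def semidirect_def id_in_Aut acts_def R_map_def assms
        intro!: exI[of _ 0])
  moreover have "family_of dot \<mu> = family_of dot True" for \<mu>
    by (simp add: family_of_def R_map_def[abs_def] assms)
  ultimately show "\<not> condition_b (family_of dot)"
    unfolding condition_b_def by metis
qed

end

theory Submission
  imports Defs
begin

text \<open>
  Write \<open>\<gamma>\<^sub>l(b)(a) = dot l a b + a\<close>.  The first and third axioms say that every \<open>\<gamma>\<^sub>l(b)\<close> is an automorphism,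
  so the family attached to a brace consists of the graphs of the maps \<open>\<gamma>\<^sub>l\<close> from \<open>A\<close> to \<open>Aut(A)\<close>, and
  condition (a) says precisely that a family consists of such graphs.  The second axiom becomes
  \<open>\<gamma>\<^sub>l(c + \<gamma>\<^sub>l(c)(b)) = \<gamma>\<^sub>l(c) \<circ> \<gamma>\<^sub>\<mu>(b)\<close> with \<open>\<mu> = phi l c\<close>, which says that left translation by
  \<open>(c, \<gamma>\<^sub>l(c))\<close> carries the graph of \<open>\<gamma>\<^sub>\<mu>\<close> into that of \<open>\<gamma>\<^sub>l\<close>.  Since both are graphs over all of \<open>A\<close> and
  \<open>b \<mapsto> c + \<gamma>\<^sub>l(c)(b)\<close> is onto, this inclusion is an equality.
\<close>

section \<open>Maps into the automorphism group and their graphs\<close>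

definition gamma ::
  "('h \<Rightarrow> 'a::ab_group_add \<Rightarrow> 'a \<Rightarrow> 'a) \<Rightarrow> 'h \<Rightarrow> 'a \<Rightarrow> 'a \<Rightarrow> 'a" where
  "gamma dot l b a = dot l a b + a"

definition aut_graph :: "('h \<Rightarrow> 'a \<Rightarrow> 'a \<Rightarrow> 'a) \<Rightarrow> 'h \<Rightarrow> ('a \<times> ('a \<Rightarrow> 'a)) set" where
  "aut_graph F l = range (\<lambda>a. (a, F l a))"

lemma mem_aut_graph [simp]: "(a, f) \<in> aut_graph F l \<longleftrightarrow> f = F l a"
  by (auto simp: aut_graph_def)

lemma aut_graph_eq_iff: "aut_graph F l = aut_graph G m \<longleftrightarrow> F l = G m"
proof
  assume eq: "aut_graph F l = aut_graph G m"
  have "F l a = G m a" for a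
    using mem_aut_graph[of a "F l a" F l] unfolding eq by simp
  then show "F l = G m" by (rule ext)
qed (simp add: aut_graph_def)

lemma gamma_eq_iff: "gamma dot l = gamma dot m \<longleftrightarrow> dot l = dot m"
  by (auto simp: gamma_def fun_eq_iff)

lemma gamma_in_Aut_iff:
  "gamma dot l b \<in> Aut \<longleftrightarrow>
     (\<forall>a a'. dot l (a + a') b = dot l a b + dot l a' b) \<and> bij (\<lambda>a. dot l a b + a)"
  by (simp add: Aut_def additive_def gamma_def[abs_def] algebra_simps)

text \<open>The first axiom splits \<open>dot l (dot m a b + a) c\<close>; after that the two
  equations differ only by a summand \<open>a\<close> on each side. The parameter \<open>m\<close>
  is left free and later becomes \<open>phi l c\<close>.\<close>

lemma second_axiom_iff:
  assumes "gamma dot l c \<in> Aut"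
  shows "dot l a (dot l b c + b + c) = dot l (dot m a b) c + dot m a b + dot l a c \<longleftrightarrow>
    gamma dot l (c + gamma dot l c b) a = gamma dot l c (gamma dot m b a)"
proof -
  have "dot l (x + y) c = dot l x c + dot l y c" for x y
    using assms by (simp add: gamma_in_Aut_iff)
  then show ?thesis by (auto simp: gamma_def ac_simps)
qed

lemma dynamical_brace_iff:
  "dynamical_brace dot phi \<longleftrightarrow>
     (\<forall>l b. gamma dot l b \<in> Aut) \<and>
     (\<forall>l c b. gamma dot l (c + gamma dot l c b) = gamma dot l c \<circ> gamma dot (phi l c) b)"
  (is "_ \<longleftrightarrow> ?aut \<and> ?comp")
proof -
  have "dynamical_brace dot phi \<longleftrightarrow> ?aut \<and>
     (\<forall>l a b c. dot l a (dot l b c + b + c) =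
        dot l (dot (phi l c) a b) c + dot (phi l c) a b + dot l a c)"
    unfolding dynamical_brace_def gamma_in_Aut_iff by blast
  also have "\<dots> \<longleftrightarrow> ?aut \<and> ?comp"
    by (auto simp: second_axiom_iff fun_eq_iff)
  finally show ?thesis .
qed

text \<open>\<open>R_map dot l a\<close> is the action of \<open>(a, gamma dot l a)\<close>, and by
  injectivity of \<open>acts\<close> no other pair acts in the same way.\<close>

lemma family_of_eq_aut_graph:
  fixes dot :: "'h \<Rightarrow> 'a::ab_group_add \<Rightarrow> 'a \<Rightarrow> 'a"
  assumes "\<And>l b. gamma dot l b \<in> Aut"
  shows "family_of dot = aut_graph (gamma dot)"
proof (rule ext, rule Set.set_eqI)
  fix l and p :: "'a \<times> ('a \<Rightarrow> 'a)"
  have R: "R_map dot l a = acts (a, gamma dot l a)" for a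
    by (simp add: R_map_def gamma_def acts_def fun_eq_iff)
  have car: "(a, gamma dot l a) \<in> carrier semidirect" for a
    using assms by (simp add: semidirect_def)
  have "p \<in> family_of dot l \<longleftrightarrow> (\<exists>a. p = (a, gamma dot l a))"
    using car by (auto simp: family_of_def R inj_on_eq_iff[OF inj_on_acts])
  then show "p \<in> family_of dot l \<longleftrightarrow> p \<in> aut_graph (gamma dot) l"
    by (auto simp: aut_graph_def)
qed

lemma aut_graph_subset: "(\<And>l b. F l b \<in> Aut) \<Longrightarrow> subset_family (aut_graph F)"
  by (auto simp: subset_family_def aut_graph_def semidirect_def)

lemma aut_graph_condition_a: "(\<And>l b. F l b \<in> Aut) \<Longrightarrow> condition_a (aut_graph F)"
  by (auto simp: condition_a_def)

lemma aut_at_aut_graph: "(\<And>l b. F l b \<in> Aut) \<Longrightarrow> aut_at (aut_graph F) = F"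
  by (auto simp: aut_at_def fun_eq_iff intro!: fun_cong[OF the_equality])

lemma condition_a_aut_graph:
  assumes "subset_family S" "condition_a S"
  shows "aut_at S l b \<in> Aut" and "S = aut_graph (aut_at S)"
proof -
  have at: "aut_at S l b \<in> Aut \<and> (b, aut_at S l b) \<in> S l" for l b
    unfolding aut_at_def by (rule theI'[of "\<lambda>f. f \<in> Aut \<and> (b, f) \<in> S l"])
      (use assms(2) in \<open>unfold condition_a_def, blast\<close>)
  then show "aut_at S l b \<in> Aut" by blast
  \<comment> \<open>The uniqueness in \<open>condition_a\<close> compares automorphisms only, so
    \<open>subset_family\<close> is used to place \<open>f\<close> in \<open>Aut\<close>
    first.\<close>
  have "f = aut_at S l b" if "(b, f) \<in> S l" for l b f
  proof -
    have "f \<in> Aut"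
      using that assms(1) by (auto simp: subset_family_def semidirect_def)
    with that at[of l b] assms(2) show ?thesis
      unfolding condition_a_def by blast
  qed
  with at have "(b, f) \<in> S l \<longleftrightarrow> (b, f) \<in> aut_graph (aut_at S) l" for l b f
    by (metis mem_aut_graph)
  then show "S = aut_graph (aut_at S)"
    by (intro ext) auto
qed

section \<open>Left translation of graphs\<close>

lemma (in group) inv_l_coset_eq_iff:
  assumes "p \<in> carrier G" "S \<subseteq> carrier G" "T \<subseteq> carrier G"
  shows "inv p <# S = T \<longleftrightarrow> S = p <# T"
  using assms by (metis inv_closed l_coset_subset_G lcos_m_assoc lcos_mult_one l_inv r_inv)

lemma aut_graph_translate_iff:
  assumes F: "\<And>l b. F l b \<in> Aut"
  shows "inv\<^bsub>semidirect\<^esub> (c, F l c) <#\<^bsub>semidirect\<^esub> aut_graph F l = aut_graph F m \<longleftrightarrow>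
    (\<forall>b. F l (c + F l c b) = F l c \<circ> F m b)"
proof -
  have sub: "aut_graph F k \<subseteq> carrier semidirect" for k
    using aut_graph_subset[of F, OF F] by (simp add: subset_family_def)
  \<comment> \<open>Moving the inverse to the other side avoids computing it in the semidirect
    product.\<close>
  have "inv\<^bsub>semidirect\<^esub> (c, F l c) <#\<^bsub>semidirect\<^esub> aut_graph F l = aut_graph F m \<longleftrightarrow>
      aut_graph F l = (c, F l c) <#\<^bsub>semidirect\<^esub> aut_graph F m"
    by (rule group.inv_l_coset_eq_iff[OF group_semidirect _ sub sub])
      (simp add: semidirect_def F)
  also have "(c, F l c) <#\<^bsub>semidirect\<^esub> aut_graph F m =
      range (\<lambda>b. (c + F l c b, F l c \<circ> F m b))" (is "_ = ?T")
    by (auto simp: l_coset_def semidirect_def aut_graph_def)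
  also have "aut_graph F l = ?T \<longleftrightarrow> (\<forall>b. F l (c + F l c b) = F l c \<circ> F m b)"
  proof
    assume "aut_graph F l = ?T"
    then have "(c + F l c b, F l c \<circ> F m b) \<in> aut_graph F l" for b
      by blast
    then show "\<forall>b. F l (c + F l c b) = F l c \<circ> F m b" by simp
  next
    assume *: "\<forall>b. F l (c + F l c b) = F l c \<circ> F m b"
    have "surj (F l c)"
      using F by (simp add: Aut_def bij_is_surj)
    \<comment> \<open>Here \<open>b\<close> is a preimage of \<open>a - c\<close> under
      \<open>F l c\<close>.\<close>
    then have surj: "\<exists>b. a = c + F l c b" for a
      by (metis add_diff_cancel_left' diff_add_cancel add.commute surjD)
    have "(a, F l a) \<in> ?T" for a
      using surj[of a] * by auto
    then have "aut_graph F l \<subseteq> ?T" by (auto simp: aut_graph_def)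
    moreover have "?T \<subseteq> aut_graph F l" using * by auto
    ultimately show "aut_graph F l = ?T" by blast
  qed
  finally show ?thesis .
qed

lemma translates_along_aut_graph_iff:
  assumes "\<And>l b. F l b \<in> Aut"
  shows "translates_along (aut_graph F) phi \<longleftrightarrow>
    (\<forall>l c b. F l (c + F l c b) = F l c \<circ> F (phi l c) b)"
  by (simp add: translates_along_def aut_at_aut_graph[of F, OF assms]
      aut_graph_translate_iff[of F, OF assms])

section \<open>From braces to families\<close>

lemma brace_family:
  assumes "dynamical_brace dot phi"
  shows "family_of dot = aut_graph (gamma dot)"
    and "subset_family (family_of dot)" and "condition_a (family_of dot)"
    and "translates_along (family_of dot) phi" and "aut_at (family_of dot) = gamma dot"
proof -
  have aut: "\<And>l b. gamma dot l b \<in> Aut"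
    and comp: "\<forall>l c b. gamma dot l (c + gamma dot l c b) = gamma dot l c \<circ> gamma dot (phi l c) b"
    using assms by (simp_all add: dynamical_brace_iff)
  note graph = family_of_eq_aut_graph[OF aut]
  show "family_of dot = aut_graph (gamma dot)" by (rule graph)
  show "subset_family (family_of dot)"
    unfolding graph by (rule aut_graph_subset[OF aut])
  show "condition_a (family_of dot)"
    unfolding graph by (rule aut_graph_condition_a[OF aut])
  show "translates_along (family_of dot) phi"
    unfolding graph translates_along_aut_graph_iff[of "gamma dot", OF aut] by (rule comp)
  show "aut_at (family_of dot) = gamma dot"
    unfolding graph by (rule aut_at_aut_graph[OF aut])
qed

lemma dot_of_family_of: "dynamical_brace dot phi \<Longrightarrow> dot_of (family_of dot) = dot"
  by (simp add: fun_eq_iff dot_of_def brace_family(5) gamma_def)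

lemma acts_family_of:
  assumes "dynamical_brace dot phi"
  shows "acts ` family_of dot l = {R_map dot l a | a. True}"
proof -
  have "acts (a, gamma dot l a) = R_map dot l a" for a
    by (simp add: R_map_def gamma_def acts_def fun_eq_iff)
  then show ?thesis
    by (auto simp: brace_family(1)[OF assms] aut_graph_def image_image)
qed

lemma family_of_eq_iff:
  assumes "dynamical_brace dot phi"
  shows "family_of dot l = family_of dot m \<longleftrightarrow> dot l = dot m"
  by (simp add: brace_family(1)[OF assms] aut_graph_eq_iff gamma_eq_iff)

text \<open>Existence of \<mu> is automatic, since \<open>phi l a\<close> always serves. Any other
  candidate has the same member of the family, hence the same multiplication, so only uniqueness is
  at stake.\<close>

lemma condition_b_family_of_iff:
  assumes "dynamical_brace dot phi"
  shows "condition_b (family_of dot) \<longleftrightarrow> phi_determined dot phi"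
proof -
  let ?S = "family_of dot"
  have mem: "p \<in> ?S l \<longleftrightarrow> (\<exists>a. p = (a, gamma dot l a))" for p l
    by (auto simp: brace_family(1)[OF assms] aut_graph_def)
  have tr: "inv\<^bsub>semidirect\<^esub> (a, gamma dot l a) <#\<^bsub>semidirect\<^esub> ?S l = ?S (phi l a)" for l a
    using brace_family(4)[OF assms] by (simp add: translates_along_def brace_family(5)[OF assms])
  have "condition_b ?S \<longleftrightarrow> (\<forall>l a. \<exists>!\<mu>. ?S (phi l a) = ?S \<mu>)"
    unfolding condition_b_def Ball_def mem by (auto simp: tr)
  also have "\<dots> \<longleftrightarrow> phi_determined dot phi"
    unfolding family_of_eq_iff[OF assms] phi_determined_def by metis
  finally show ?thesis .
qed

text \<open>The description in \<open>phi_of\<close> selects among the parameters that share the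
  multiplication of \<open>phi l a\<close>; \<open>phi_determined\<close> leaves just one.\<close>

lemma phi_of_family_of:
  assumes "dynamical_brace dot phi" "phi_determined dot phi"
  shows "phi_of (family_of dot) = phi"
proof (intro ext)
  fix l a
  have "inv\<^bsub>semidirect\<^esub> (a, aut_at (family_of dot) l a) <#\<^bsub>semidirect\<^esub> family_of dot l =
      family_of dot (phi l a)"
    using brace_family(4)[OF assms(1)] by (simp add: translates_along_def)
  then have "phi_of (family_of dot) l a = (THE \<mu>. dot (phi l a) = dot \<mu>)"
    by (simp add: phi_of_def family_of_eq_iff[OF assms(1)])
  also have "\<dots> = phi l a"
    by (rule the_equality) (use assms(2) in \<open>auto simp: phi_determined_def\<close>)
  finally show "phi_of (family_of dot) l a = phi l a" .
qed

section \<open>From families to braces\<close>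

lemma gamma_dot_of: "gamma (dot_of S) = aut_at S"
  by (simp add: fun_eq_iff gamma_def dot_of_def)

lemma family_of_dot_of:
  assumes "subset_family S" "condition_a S"
  shows "family_of (dot_of S) = S"
  using condition_a_aut_graph[OF assms] family_of_eq_aut_graph[of "dot_of S"]
  by (simp add: gamma_dot_of)

text \<open>Stated for any \<open>phi\<close> along which \<open>S\<close> translates, so that it
  serves both \<open>phi_of S\<close> and a \<open>phi\<close> kept as separate data.\<close>

lemma dynamical_brace_dot_of:
  assumes "subset_family S" "condition_a S" "translates_along S phi"
  shows "dynamical_brace (dot_of S) phi"
proof -
  note aut = condition_a_aut_graph(1)[OF assms(1,2)]
  have "translates_along (aut_graph (aut_at S)) phi"
    using assms(3) condition_a_aut_graph(2)[OF assms(1,2)] by simp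
  then show ?thesis
    by (simp add: dynamical_brace_iff gamma_dot_of aut
        translates_along_aut_graph_iff[of "aut_at S", OF aut])
qed

lemma translates_along_phi_of:
  assumes "subset_family S" "condition_a S" "condition_b S"
  shows "translates_along S (phi_of S)"
proof -
  have "(a, aut_at S l a) \<in> S l" for l a
    using condition_a_aut_graph(2)[OF assms(1,2)] by (metis mem_aut_graph)
  then have ex1: "\<exists>!\<mu>. inv\<^bsub>semidirect\<^esub> (a, aut_at S l a) <#\<^bsub>semidirect\<^esub> S l = S \<mu>" for l a
    using assms(3) unfolding condition_b_def by blast
  show ?thesis
    unfolding translates_along_def phi_of_def using theI'[OF ex1] by blast
qed

lemma family_brace:
  assumes "subset_family S" "condition_a S" "condition_b S"
  shows "dynamical_brace (dot_of S) (phi_of S)" and "phi_determined (dot_of S) (phi_of S)"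
proof -
  show brace: "dynamical_brace (dot_of S) (phi_of S)"
    using assms by (intro dynamical_brace_dot_of translates_along_phi_of) auto
  show "phi_determined (dot_of S) (phi_of S)"
    \<comment> \<open>As \<open>family_of (dot_of S) = S\<close>, condition (b) for \<open>S\<close>
      is condition (b) for the family of the new brace.\<close>
    using condition_b_family_of_iff[OF brace] assms by (simp add: family_of_dot_of)
qed

section \<open>The two one-to-one correspondences\<close>

lemma bij_betw_determined_braces:
  "bij_betw (\<lambda>(dot :: 'h \<Rightarrow> 'a::ab_group_add \<Rightarrow> 'a \<Rightarrow> 'a, phi). family_of dot)
     {(dot, phi). dynamical_brace dot phi \<and> phi_determined dot phi}
     {S. subset_family S \<and> condition_a S \<and> condition_b S}"
  by (rule bij_betw_byWitness[where f' = "\<lambda>S. (dot_of S, phi_of S)"])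
    (auto simp: dot_of_family_of phi_of_family_of family_of_dot_of family_brace
      brace_family(2,3) condition_b_family_of_iff)

text \<open>Carrying \<open>phi\<close> along on both sides makes the correspondence cover all
  braces, including those whose \<open>phi\<close> the family does not determine.\<close>

lemma bij_betw_braces:
  "bij_betw (\<lambda>(dot :: 'h \<Rightarrow> 'a::ab_group_add \<Rightarrow> 'a \<Rightarrow> 'a, phi). (family_of dot, phi))
     {(dot, phi). dynamical_brace dot phi}
     {(S, phi). subset_family S \<and> condition_a S \<and> translates_along S phi}"
  by (rule bij_betw_byWitness[where f' = "\<lambda>(S, phi). (dot_of S, phi)"])
    (auto simp: dot_of_family_of family_of_dot_of dynamical_brace_dot_of brace_family(2,3,4))

theorem theorem4p1:
  shows
    "(\<forall>(dot :: 'h \<Rightarrow> 'a::ab_group_add \<Rightarrow> 'a \<Rightarrow> 'a) phi. dynamical_brace dot phi \<longrightarrow>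
        (\<forall>l. acts ` family_of dot l = {R_map dot l a | a. True}) \<and>
        subset_family (family_of dot) \<and>
        condition_a (family_of dot) \<and>
        translates_along (family_of dot) phi \<and>
        (condition_b (family_of dot) \<longleftrightarrow> phi_determined dot phi))
     \<and>
     (\<forall>S :: 'h \<Rightarrow> ('a \<times> ('a \<Rightarrow> 'a)) set.
        subset_family S \<and> condition_a S \<and> condition_b S \<longrightarrow>
        dynamical_brace (dot_of S) (phi_of S))
     \<and>
     (bij_betw (\<lambda>(dot :: 'h \<Rightarrow> 'a \<Rightarrow> 'a \<Rightarrow> 'a, phi). family_of dot)
        {(dot, phi). dynamical_brace dot phi \<and> phi_determined dot phi}
        {S. subset_family S \<and> condition_a S \<and> condition_b S} \<and>
      (\<forall>(dot :: 'h \<Rightarrow> 'a \<Rightarrow> 'a \<Rightarrow> 'a) phi. dynamical_brace dot phi \<and> phi_determined dot phi \<longrightarrow>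
         dot_of (family_of dot) = dot \<and> phi_of (family_of dot) = phi) \<and>
      (\<forall>S :: 'h \<Rightarrow> ('a \<times> ('a \<Rightarrow> 'a)) set.
         subset_family S \<and> condition_a S \<and> condition_b S \<longrightarrow> family_of (dot_of S) = S) \<and>
      bij_betw (\<lambda>(dot :: 'h \<Rightarrow> 'a \<Rightarrow> 'a \<Rightarrow> 'a, phi). (family_of dot, phi))
        {(dot, phi). dynamical_brace dot phi}
        {(S, phi). subset_family S \<and> condition_a S \<and> translates_along S phi})"
  by (intro conjI allI impI; (elim conjE)?)
    (simp_all add: acts_family_of brace_family(2,3,4) condition_b_family_of_iff family_brace(1)
      dot_of_family_of phi_of_family_of family_of_dot_of bij_betw_determined_braces bij_betw_braces)

end
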